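(* Let $(X,\mathcal{U})$ be a uniform space. If $f\colon(X,\mathcal{U})\to(X,\mathcal{U})$ is continuous, then $\widehat{f}\colon(\mathcal{F}(X),\mathcal{U}_0)\to(\mathcal{F}(X),\mathcal{U}_0)$ is continuous.
   Context: A uniform space $(X,\mathcal{U})$ is a non-empty set $X$ with a uniformity $\mathcal{U}$ given by entourages of the diagonal, assumed separated: $\bigcap_{U\in\mathcal{U}}U=\Delta_X$. For $U\in\mathcal{U}$, $x\in X$, $A\subseteq X$, put $U(x)=\{y\in X:(x,y)\in U\}$ and $U(A)=\bigcup_{x\in A}U(x)$. The induced topology is $\tau(\mathcal{U})=\{V\subseteq X: \text{for every }x\in V\text{ there is }U\in\mathcal{U}\text{ with }U(x)\subseteq V\}$. Continuity of maps between uniform spaces always means continuity with respect to the induced topologies (not uniform continuity). $\mathcal{K}(X)$ is the set of non-empty compact subsets of $(X,\tau(\mathcal{U}))$, and for $U\in\mathcal{U}$, $\mathcal{K}[U]=\{(A,B)\in\mathcal{K}(X)\times\mathcal{K}(X): A\subseteq U(B),\ B\subseteq U(A)\}$. Let $\mathbb{I}=[0,1]$. A fuzzy set on $X$ is a function $u\colon X\to\mathbb{I}$; its $\alpha$-cut is $u_\alpha=\{x\in X:u(x)\ge\alpha\}$ for $\alpha\in(0,1]$, and its support is $u_0=\overline{\{x\in X:u(x)>0\}}$. $u$ is normal if $u(x)=1$ for some $x$. $\mathcal{F}(X)$ is the set of all normal upper semicontinuous fuzzy sets on $X$ with compact support. Zadeh's extension $\widehat{f}\colon\mathcal{F}(X)\to\mathcal{F}(X)$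 of a continuous $f\colon X\to X$ is $\widehat{f}(u)(x)=\sup\{u(z):z\in f^{-1}(x)\}$ if $f^{-1}(x)\ne\emptyset$, and $\widehat{f}(u)(x)=0$ otherwise. Let $\mathbb{T}$ be the set of increasing homeomorphisms of $[0,1]$ onto itself and $\|t\|=\sup\{|t(\alpha)-\alpha|:\alpha\in\mathbb{I}\}$ for $t\in\mathbb{T}$. The Skorokhod uniformity $\mathcal{U}_0$ on $\mathcal{F}(X)$ has base $\{G[U,\epsilon]:U\in\mathcal{U},\ \epsilon>0\}$, where $G[U,\epsilon]$ is the set of $(u,v)\in\mathcal{F}(X)\times\mathcal{F}(X)$ for which there is $t\in\mathbb{T}$ with $\|t\|<\epsilon$ and $(u_\alpha,v_{t(\alpha)})\in\mathcal{K}[U]$ for all $\alpha\in\mathbb{I}$ (it is known that this is a base of a uniformity). *)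

theory Defs
  imports "HOL-Analysis.Analysis"
begin

section \<open>Uniform spaces\<close>

text \<open>A uniform space is a type of class \<^class>\<open>uniform_space\<close>. Its uniformity is
  there a filter on pairs; the entourages are the members of that filter. The class axiom
  \<open>open_uniformity\<close> says that \<open>open\<close> is the topology induced by the uniformity. The class
  does not include separation. For a set \<open>A\<close>, \<open>U(A)\<close> is the relational image \<open>U `` A\<close>.\<close>

definition entourages :: "('a::uniform_space \<times> 'a) set set" where
  "entourages = {U. eventually (\<lambda>p. p \<in> U) uniformity}"

definition separated_uniformity :: "('a::uniform_space) itself \<Rightarrow> bool" where
  "separated_uniformity _ \<longleftrightarrow> (\<Inter>(entourages :: ('a \<times> 'a) set set)) = Id"

lemma open_iff_entourages:
  fixes V :: "'a::uniform_space set"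
  shows "open V \<longleftrightarrow> (\<forall>x\<in>V. \<exists>U\<in>entourages. U `` {x} \<subseteq> V)"
proof -
  have "eventually (\<lambda>(x', y). x' = x \<longrightarrow> y \<in> V) uniformity
          \<longleftrightarrow> (\<exists>U\<in>entourages. U `` {x} \<subseteq> V)" for x
  proof
    assume "eventually (\<lambda>(x', y). x' = x \<longrightarrow> y \<in> V) uniformity"
    then have "{(x', y). x' = x \<longrightarrow> y \<in> V} \<in> entourages"
      by (simp add: entourages_def case_prod_unfold)
    then show "\<exists>U\<in>entourages. U `` {x} \<subseteq> V"
      by (rule bexI[rotated]) auto
  next
    assume "\<exists>U\<in>entourages. U `` {x} \<subseteq> V"
    then obtain U where "eventually (\<lambda>p. p \<in> U) uniformity" "U `` {x} \<subseteq> V"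
      by (auto simp: entourages_def)
    then show "eventually (\<lambda>(x', y). x' = x \<longrightarrow> y \<in> V) uniformity"
      by (elim eventually_mono) auto
  qed
  then show ?thesis by (simp add: open_uniformity)
qed

definition compact_rel :: "('a::uniform_space \<times> 'a) set \<Rightarrow> ('a set \<times> 'a set) set" where
  "compact_rel U = {(A, B). compact A \<and> A \<noteq> {} \<and> compact B \<and> B \<noteq> {} \<and>
                            A \<subseteq> U `` B \<and> B \<subseteq> U `` A}"


section \<open>Fuzzy sets\<close>

text \<open>A fuzzy set is a real-valued function with values in \<open>[0,1]\<close>. The value of the cut
  at \<open>0\<close> is the support, and the cuts are only used at levels in \<open>[0,1]\<close>.\<close>

definition alpha_cut :: "('a::topological_space \<Rightarrow> real) \<Rightarrow> real \<Rightarrow> 'a set" where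
  "alpha_cut u \<alpha> = (if \<alpha> = 0 then closure {x. u x > 0} else {x. u x \<ge> \<alpha>})"

definition upper_semicontinuous :: "('a::topological_space \<Rightarrow> real) \<Rightarrow> bool" where
  "upper_semicontinuous u \<longleftrightarrow> (\<forall>x c. u x < c \<longrightarrow> eventually (\<lambda>y. u y < c) (nhds x))"

definition fuzzy_sets :: "('a::topological_space \<Rightarrow> real) set" where
  "fuzzy_sets = {u. (\<forall>x. u x \<in> {0..1}) \<and> (\<exists>x. u x = 1) \<and>
                    upper_semicontinuous u \<and> compact (alpha_cut u 0)}"

definition zadeh :: "('a \<Rightarrow> 'a) \<Rightarrow> ('a \<Rightarrow> real) \<Rightarrow> 'a \<Rightarrow> real" where
  "zadeh f u x = (if f -` {x} \<noteq> {} then (SUP z\<in>f -` {x}. u z) else 0)"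


section \<open>The Skorokhod uniformity and its topology\<close>

text \<open>Only the values on \<open>[0,1]\<close> of a function in \<open>time_changes\<close> matter.\<close>

definition time_changes :: "(real \<Rightarrow> real) set" where
  "time_changes = {t. strict_mono_on {0..1} t \<and> (\<exists>s. homeomorphism {0..1} {0..1} t s)}"

definition time_norm :: "(real \<Rightarrow> real) \<Rightarrow> real" where
  "time_norm t = (SUP \<alpha>\<in>{0..1}. \<bar>t \<alpha> - \<alpha>\<bar>)"

definition skorokhod_rel ::
  "('a::uniform_space \<times> 'a) set \<Rightarrow> real \<Rightarrow> (('a \<Rightarrow> real) \<times> ('a \<Rightarrow> real)) set" where
  "skorokhod_rel U \<epsilon> = {(u, v). u \<in> fuzzy_sets \<and> v \<in> fuzzy_sets \<and>
     (\<exists>t\<in>time_changes. time_norm t < \<epsilon> \<and>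
        (\<forall>\<alpha>\<in>{0..1}. (alpha_cut u \<alpha>, alpha_cut v (t \<alpha>)) \<in> compact_rel U))}"

definition skorokhod_uniformity :: "(('a::uniform_space \<Rightarrow> real) \<times> ('a \<Rightarrow> real)) set set" where
  "skorokhod_uniformity = {W. W \<subseteq> fuzzy_sets \<times> fuzzy_sets \<and>
     (\<exists>U\<in>entourages. \<exists>\<epsilon>>0. skorokhod_rel U \<epsilon> \<subseteq> W)}"

definition skorokhod_topology :: "('a::uniform_space \<Rightarrow> real) topology" where
  "skorokhod_topology = topology (\<lambda>V. V \<subseteq> fuzzy_sets \<and>
     (\<forall>u\<in>V. \<exists>W\<in>skorokhod_uniformity. W `` {u} \<subseteq> V))"

lemma skorokhod_rel_mono:
  assumes "U \<subseteq> U'" "\<epsilon> \<le> \<epsilon>'"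
  shows "skorokhod_rel U \<epsilon> \<subseteq> skorokhod_rel U' \<epsilon>'"
proof (rule subrelI)
  fix u v assume "(u, v) \<in> skorokhod_rel U \<epsilon>"
  then obtain t where "u \<in> fuzzy_sets" "v \<in> fuzzy_sets" "t \<in> time_changes" "time_norm t < \<epsilon>"
      and t: "\<forall>\<alpha>\<in>{0..1}. (alpha_cut u \<alpha>, alpha_cut v (t \<alpha>)) \<in> compact_rel U"
    unfolding skorokhod_rel_def by blast
  moreover have "time_norm t < \<epsilon>'" using \<open>time_norm t < \<epsilon>\<close> assms(2) by linarith
  moreover have "compact_rel U \<subseteq> compact_rel U'"
    using assms(1) unfolding compact_rel_def by blast
  then have "\<forall>\<alpha>\<in>{0..1}. (alpha_cut u \<alpha>, alpha_cut v (t \<alpha>)) \<in> compact_rel U'"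
    using t by blast
  ultimately show "(u, v) \<in> skorokhod_rel U' \<epsilon>'"
    unfolding skorokhod_rel_def by blast
qed

lemma skorokhod_uniformity_Int:
  assumes "W \<in> skorokhod_uniformity" "W' \<in> skorokhod_uniformity"
  shows "W \<inter> W' \<in> skorokhod_uniformity"
proof -
  obtain U \<epsilon> U' \<epsilon>' where
    *: "U \<in> entourages" "\<epsilon> > 0" "skorokhod_rel U \<epsilon> \<subseteq> W"
       "U' \<in> entourages" "\<epsilon>' > 0" "skorokhod_rel U' \<epsilon>' \<subseteq> W'"
    using assms by (auto simp: skorokhod_uniformity_def)
  have "skorokhod_rel (U \<inter> U') (min \<epsilon> \<epsilon>') \<subseteq> skorokhod_rel U \<epsilon> \<inter> skorokhod_rel U' \<epsilon>'"
    by (intro Int_greatest skorokhod_rel_mono) auto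
  moreover have "U \<inter> U' \<in> entourages"
    using * by (auto simp: entourages_def eventually_conj)
  moreover have "min \<epsilon> \<epsilon>' > 0" using * by simp
  moreover have "W \<inter> W' \<subseteq> fuzzy_sets \<times> fuzzy_sets"
    using assms unfolding skorokhod_uniformity_def by blast
  ultimately show ?thesis
    using *(3,6) unfolding skorokhod_uniformity_def mem_Collect_eq
    by (meson Int_mono order_trans)
qed

lemma openin_skorokhod_topology:
  "openin skorokhod_topology V \<longleftrightarrow> V \<subseteq> fuzzy_sets \<and>
     (\<forall>u\<in>V. \<exists>W\<in>skorokhod_uniformity. W `` {u} \<subseteq> V)"
proof -
  have "istopology (\<lambda>V. V \<subseteq> fuzzy_sets \<and>
     (\<forall>u\<in>V. \<exists>W\<in>skorokhod_uniformity. W `` {u} \<subseteq> (V :: ('a \<Rightarrow> real) set)))"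
    (is "istopology ?P")
    unfolding istopology_def
  proof (intro conjI allI impI)
    fix S T assume S: "?P S" and T: "?P T"
    show "S \<inter> T \<subseteq> fuzzy_sets" using S by auto
    show "\<forall>u\<in>S \<inter> T. \<exists>W\<in>skorokhod_uniformity. W `` {u} \<subseteq> S \<inter> T"
    proof
      fix u assume "u \<in> S \<inter> T"
      then obtain W W' where "W \<in> skorokhod_uniformity" "W `` {u} \<subseteq> S"
          "W' \<in> skorokhod_uniformity" "W' `` {u} \<subseteq> T"
        using S T by blast
      then show "\<exists>W\<in>skorokhod_uniformity. W `` {u} \<subseteq> S \<inter> T"
        by (intro bexI[of _ "W \<inter> W'"] skorokhod_uniformity_Int) auto
    qed
  next
    fix K assume "\<forall>S\<in>K. ?P S"
    then show "\<Union>K \<subseteq> fuzzy_sets"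
      and "\<forall>u\<in>\<Union>K. \<exists>W\<in>skorokhod_uniformity. W `` {u} \<subseteq> \<Union>K"
      by (blast, meson UnionE Union_upper order_trans)
  qed
  then show ?thesis
    by (simp add: skorokhod_topology_def topology_inverse')
qed

lemma topspace_skorokhod_topology: "topspace skorokhod_topology = fuzzy_sets"
proof -
  have "(UNIV :: ('a \<times> 'a) set) \<in> entourages" by (simp add: entourages_def)
  moreover have "skorokhod_rel (UNIV :: ('a \<times> 'a) set) 1 \<subseteq> fuzzy_sets \<times> fuzzy_sets"
    unfolding skorokhod_rel_def by blast
  ultimately have "fuzzy_sets \<times> fuzzy_sets \<in> (skorokhod_uniformity :: (('a \<Rightarrow> real) \<times> _) set set)"
    unfolding skorokhod_uniformity_def mem_Collect_eq using zero_less_one by blast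
  moreover have "(fuzzy_sets \<times> fuzzy_sets) `` {u} \<subseteq> fuzzy_sets" for u :: "'a \<Rightarrow> real"
    by blast
  ultimately have "openin skorokhod_topology (fuzzy_sets :: ('a \<Rightarrow> real) set)"
    unfolding openin_skorokhod_topology by (intro conjI subset_refl ballI bexI)
  then have "fuzzy_sets \<subseteq> topspace (skorokhod_topology :: ('a \<Rightarrow> real) topology)"
    by (rule openin_subset)
  moreover have "topspace (skorokhod_topology :: ('a \<Rightarrow> real) topology) \<subseteq> fuzzy_sets"
    using openin_topspace[of "skorokhod_topology :: ('a \<Rightarrow> real) topology"]
    unfolding openin_skorokhod_topology by (rule conjunct1)
  ultimately show ?thesis by (rule subset_antisym[rotated])
qed

end

theory Submission
  imports Defs
begin

text \<open>Separation makes compact sets closed, so suprema of upper semicontinuous functions over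
  fibres of \<open>f\<close> are attained and the cut of \<open>zadeh f u\<close> at each level is the \<open>f\<close>-image of the
  cut of \<open>u\<close>. On the compact support of \<open>u\<close>, continuity of \<open>f\<close> is uniform even when the second
  point ranges over the whole space. Hence a time change that witnesses closeness of \<open>u\<close> and
  \<open>v\<close> also witnesses closeness of their images.\<close>

section \<open>Separation and uniform continuity near compact sets\<close>

lemma separated_imp_Hausdorff:
  assumes "separated_uniformity TYPE('a::uniform_space)"
  shows "Hausdorff_space (euclidean :: 'a topology)"
  unfolding Hausdorff_space_def
proof (clarsimp)
  fix x y :: 'a
  assume "x \<noteq> y"
  then have "(x, y) \<notin> \<Inter>entourages"
    using assms by (simp add: separated_uniformity_def)
  then obtain U where U: "eventually (\<lambda>p. p \<in> U) uniformity" "(x, y) \<notin> U"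
    by (auto simp: entourages_def)
  obtain D where D: "eventually D uniformity" "\<And>a b c. D (a, b) \<Longrightarrow> D (b, c) \<Longrightarrow> (a, c) \<in> U"
    using uniformity_transE[OF U(1)] by blast
  \<comment> \<open>Neighbourhoods of \<open>y\<close> are described by pairs with first entry
    \<open>y\<close>, so a condition of the form \<open>D (a, y)\<close> has to come from the
    reversed relation.\<close>
  have Ds: "eventually (\<lambda>(a, b). D (b, a)) uniformity"
    using uniformity_sym[OF D(1)] .
  have "eventually (\<lambda>a. D (x, a)) (nhds x)"
    unfolding eventually_nhds_uniformity using D(1) by (auto elim: eventually_mono)
  moreover have "eventually (\<lambda>a. D (a, y)) (nhds y)"
    unfolding eventually_nhds_uniformity using Ds by (auto elim: eventually_mono)
  ultimately obtain S T where ST: "open S" "x \<in> S" "\<And>a. a \<in> S \<Longrightarrow> D (x, a)"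
      "open T" "y \<in> T" "\<And>a. a \<in> T \<Longrightarrow> D (a, y)"
    unfolding eventually_nhds by metis
  \<comment> \<open>A common point \<open>a\<close> would give \<open>D (x, a)\<close> and
    \<open>D (a, y)\<close>, hence the excluded pair \<open>(x, y)\<close> in
    \<open>U\<close>.\<close>
  then have "disjnt S T"
    using D(2) U(2) unfolding disjnt_iff by blast
  with ST show "\<exists>S. open S \<and> (\<exists>T. open T \<and> x \<in> S \<and> y \<in> T \<and> disjnt S T)"
    by blast
qed

lemma compact_imp_closed_separated:
  assumes "separated_uniformity TYPE('a)" "compact (K :: 'a::uniform_space set)"
  shows "closed K"
  using compactin_imp_closedin[OF separated_imp_Hausdorff[OF assms(1)], of K] assms(2) by simp

text \<open>A Heine-Cantor argument: each point has an open neighbourhood with its own entourage,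
  and finitely many of these neighbourhoods cover \<open>K\<close>. Only the first point selects a
  member of the cover, so the second may leave \<open>K\<close>.\<close>

lemma continuous_uniform_near_compact:
  fixes f :: "'a::uniform_space \<Rightarrow> 'b::uniform_space"
  assumes f: "continuous_on UNIV f" and K: "compact K" and U: "U \<in> entourages"
  shows "eventually (\<lambda>(x, y). x \<in> K \<longrightarrow> (f x, f y) \<in> U) uniformity"
proof -
  have local: "\<exists>A. open A \<and> x \<in> A \<and>
      eventually (\<lambda>(p, q). p \<in> A \<longrightarrow> (f p, f q) \<in> U) uniformity" for x
  proof -
    \<comment> \<open>\<open>V\<close> is a symmetric half of \<open>U\<close>: \<open>f p\<close>
      and \<open>f q\<close> will both be compared with \<open>f x\<close>.\<close>
    obtain V where V: "eventually V uniformity" "\<And>a b. V (a, b) \<Longrightarrow> V (b, a)"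
        "\<And>a b c. V (a, b) \<Longrightarrow> V (b, c) \<Longrightarrow> (a, c) \<in> U"
    proof -
      obtain D where D: "eventually D uniformity" "\<And>a b c. D (a, b) \<Longrightarrow> D (b, c) \<Longrightarrow> (a, c) \<in> U"
        using uniformity_transE[of "\<lambda>p. p \<in> U"] U unfolding entourages_def by blast
      show thesis
        by (rule that[of "\<lambda>(a, b). D (a, b) \<and> D (b, a)"])
          (use D(2) eventually_conj[OF D(1) uniformity_sym[OF D(1)]] in
            \<open>auto simp: case_prod_unfold\<close>)
    qed
    have "eventually (\<lambda>z. V (f x, z)) (nhds (f x))"
      unfolding eventually_nhds_uniformity using V(1) by (auto elim: eventually_mono)
    moreover have "filterlim f (nhds (f x)) (nhds x)"
      using f unfolding continuous_on_def tendsto_at_iff_tendsto_nhds[symmetric] by simp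
    ultimately have "eventually (\<lambda>z. V (f x, f z)) (nhds x)"
      unfolding filterlim_iff by blast
    then have W: "eventually (\<lambda>(x', z). x' = x \<longrightarrow> V (f x, f z)) uniformity"
      unfolding eventually_nhds_uniformity .
    \<comment> \<open>Two \<open>D\<close>-steps from \<open>x\<close> stay where \<open>f\<close>
      is \<open>V\<close>-close to \<open>f x\<close>. The first step leads to \<open>p\<close> in
      \<open>A\<close>, the second to an arbitrary \<open>q\<close>.\<close>
    from uniformity_transE[OF W] obtain D where D: "eventually D uniformity"
        and "\<And>a b c. D (a, b) \<Longrightarrow> D (b, c) \<Longrightarrow> (case (a, c) of (x', z) \<Rightarrow> x' = x \<longrightarrow> V (f x, f z))"
      by blast
    then have DV: "\<And>b c. D (x, b) \<Longrightarrow> D (b, c) \<Longrightarrow> V (f x, f c)"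
      by simp
    have "eventually (\<lambda>z. D (x, z) \<and> V (f x, f z)) (nhds x)"
      using D W unfolding eventually_nhds_uniformity
      by eventually_elim auto
    then obtain A where A: "open A" "x \<in> A" "\<And>z. z \<in> A \<Longrightarrow> D (x, z) \<and> V (f x, f z)"
      unfolding eventually_nhds by blast
    have "eventually (\<lambda>(p, q). p \<in> A \<longrightarrow> (f p, f q) \<in> U) uniformity"
      using D
    proof (rule eventually_mono, clarify)
      fix p q
      assume "D (p, q)" "p \<in> A"
      then have "V (f x, f p)" "V (f x, f q)" using A(3) DV by blast+
      then show "(f p, f q) \<in> U" using V(2,3) by blast
    qed
    with A show ?thesis by blast
  qed
  define C where "C = {A. open A \<and> eventually (\<lambda>(p, q). p \<in> A \<longrightarrow> (f p, f q) \<in> U) uniformity}"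
  have "K \<subseteq> \<Union>C" "\<And>A. A \<in> C \<Longrightarrow> open A"
    unfolding C_def using local by blast+
  then obtain F where F: "F \<subseteq> C" "finite F" "K \<subseteq> \<Union>F"
    by (rule compactE[OF K])
  have "eventually (\<lambda>z. \<forall>A\<in>F. (case z of (p, q) \<Rightarrow> p \<in> A \<longrightarrow> (f p, f q) \<in> U)) uniformity"
    by (rule eventually_ball_finite[OF F(2)]) (use F(1) in \<open>auto simp: C_def\<close>)
  then show ?thesis
    by (rule eventually_mono) (use F(3) in \<open>auto simp: subset_iff\<close>)
qed

section \<open>Cuts of fuzzy sets\<close>

lemma upper_semicontinuous_iff_closed:
  "upper_semicontinuous u \<longleftrightarrow> (\<forall>c. closed {x. u x \<ge> c})"
proof -
  have "open {x. u x < c} \<longleftrightarrow> (\<forall>x. u x < c \<longrightarrow> eventually (\<lambda>y. u y < c) (nhds x))" for c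
    by (subst open_subopen) (auto simp: eventually_nhds subset_eq Ball_def)
  then have "upper_semicontinuous u \<longleftrightarrow> (\<forall>c. open {x. u x < c})"
    unfolding upper_semicontinuous_def by blast
  also have "\<dots> \<longleftrightarrow> (\<forall>c. closed {x. u x \<ge> c})"
    by (simp add: closed_def Compl_eq not_le)
  finally show ?thesis .
qed

lemma fuzzy_setsD:
  assumes "u \<in> fuzzy_sets"
  shows "0 \<le> u x" "u x \<le> 1" "\<exists>x. u x = 1" "closed {x. u x \<ge> c}" "compact (alpha_cut u 0)"
  using assms by (auto simp: fuzzy_sets_def upper_semicontinuous_iff_closed)

lemma alpha_cut_subset_support:
  assumes "\<alpha> \<ge> 0" shows "alpha_cut u \<alpha> \<subseteq> alpha_cut u 0"
  using assms closure_subset[of "{x. u x > 0}"] by (auto simp: alpha_cut_def)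

lemma compact_alpha_cut:
  assumes "u \<in> fuzzy_sets" "\<alpha> \<ge> 0"
  shows "compact (alpha_cut u \<alpha>)"
proof (cases "\<alpha> = 0")
  case False
  then have "alpha_cut u \<alpha> = alpha_cut u 0 \<inter> {x. u x \<ge> \<alpha>}"
    using alpha_cut_subset_support[OF assms(2), of u] by (auto simp: alpha_cut_def)
  then show ?thesis
    by (simp add: compact_Int_closed fuzzy_setsD[OF assms(1)])
qed (simp add: fuzzy_setsD[OF assms(1)])

section \<open>Zadeh's extension and its cuts\<close>

lemma zadeh_upper:
  assumes "u \<in> fuzzy_sets"
  shows "u z \<le> zadeh f u (f z)"
  unfolding zadeh_def
  by (auto intro!: cSUP_upper bdd_aboveI[of _ 1] fuzzy_setsD[OF assms])

text \<open>By compactness the fibre and all the cuts at levels in \<open>(0, s)\<close>, for a positive supremum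
  \<open>s\<close>, have a common point.\<close>

lemma zadeh_attained:
  fixes f :: "'a::uniform_space \<Rightarrow> 'a"
  assumes "separated_uniformity TYPE('a)" "continuous_on UNIV f" "u \<in> fuzzy_sets"
    and pos: "zadeh f u x > 0"
  obtains z where "f z = x" "u z = zadeh f u x"
proof -
  define s where "s = zadeh f u x"
  have ne: "f -` {x} \<noteq> {}" and s: "s = (SUP z\<in>f -` {x}. u z)"
    using pos by (auto simp: zadeh_def s_def split: if_splits)
  have "closed (f -` {x})"
    using compact_imp_closed_separated[OF assms(1), of "{x}"] assms(2)
    by (simp add: continuous_on_closed_vimage)
  then have K: "compact (alpha_cut u 0 \<inter> f -` {x})"
    using fuzzy_setsD(5)[OF assms(3)] by (rule compact_Int_closed[rotated])
  have "(alpha_cut u 0 \<inter> f -` {x}) \<inter> (\<Inter>c\<in>{0<..<s}. {z. u z \<ge> c}) \<noteq> {}"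
  proof (rule compact_imp_fip_image[OF K])
    fix I assume I: "finite I" "I \<subseteq> {0<..<s}"
    \<comment> \<open>Inserting \<open>s / 2\<close> covers empty \<open>I\<close> and keeps
      \<open>m\<close> strictly between 0 and \<open>s\<close>. A fibre point with value above
      \<open>m\<close> then serves all levels in \<open>I\<close> and lies in the support.\<close>
    define m where "m = Max (insert (s / 2) I)"
    have "m \<in> insert (s / 2) I"
      unfolding m_def using I(1) by (intro Max_in) auto
    then have m: "0 < m" "m < s" using I(2) pos by (auto simp: s_def)
    have "\<And>c. c \<in> I \<Longrightarrow> c \<le> m" using I(1) by (simp add: m_def)
    moreover obtain z where "f z = x" "m < u z"
      using less_cSUP_iff[of "f -` {x}" u m] ne m(2) s fuzzy_setsD(2)[OF assms(3)]
      by (auto simp: bdd_above_def)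
    moreover have "z \<in> alpha_cut u 0"
      using alpha_cut_subset_support[of m u] m \<open>m < u z\<close> by (auto simp: alpha_cut_def)
    ultimately show "(alpha_cut u 0 \<inter> f -` {x}) \<inter> (\<Inter>c\<in>I. {z. u z \<ge> c}) \<noteq> {}"
      by fastforce
  qed (rule fuzzy_setsD(4)[OF assms(3)])
  then obtain z where "z \<in> (alpha_cut u 0 \<inter> f -` {x}) \<inter> (\<Inter>c\<in>{0<..<s}. {z. u z \<ge> c})"
    by blast
  then have z: "f z = x" "\<And>c. 0 < c \<Longrightarrow> c < s \<Longrightarrow> c \<le> u z"
    by auto
  have "s \<le> u z"
    using pos z(2) by (intro dense_le_bounded[of 0 s]) (auto simp: s_def)
  with z(1) zadeh_upper[OF assms(3), of z f] that show thesis
    by (auto simp: s_def)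
qed

text \<open>At positive levels, attained suprema give one inclusion and \<open>zadeh_upper\<close>
  the other. Level 0 is a closure, so there \<open>f\<close> must also be shown to commute with the
  closure of the positivity set.\<close>

lemma alpha_cut_zadeh:
  fixes f :: "'a::uniform_space \<Rightarrow> 'a"
  assumes "separated_uniformity TYPE('a)" "continuous_on UNIV f" "u \<in> fuzzy_sets" "\<alpha> \<ge> 0"
  shows "alpha_cut (zadeh f u) \<alpha> = f ` alpha_cut u \<alpha>"
proof (cases "\<alpha> = 0")
  case True
  let ?S = "{x. u x > 0}"
  have "{x. zadeh f u x > 0} = f ` ?S"
  proof (intro equalityI subsetI)
    fix x assume "x \<in> {x. zadeh f u x > 0}"
    then show "x \<in> f ` ?S"
      using zadeh_attained[OF assms(1-3)] by (metis imageI mem_Collect_eq)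
  next
    fix x assume "x \<in> f ` ?S"
    then show "x \<in> {x. zadeh f u x > 0}"
      using zadeh_upper[OF assms(3)] by (auto intro: less_le_trans)
  qed
  \<comment> \<open>The image of the compact support is compact, hence closed by separation. The
    reverse inclusion is continuity of \<open>f\<close>.\<close>
  moreover have "closure (f ` ?S) = f ` closure ?S"
  proof
    have "compact (f ` closure ?S)"
      using fuzzy_setsD(5)[OF assms(3)] continuous_on_subset[OF assms(2)]
      by (intro compact_continuous_image) (auto simp: alpha_cut_def)
    then show "closure (f ` ?S) \<subseteq> f ` closure ?S"
      by (intro closure_minimal compact_imp_closed_separated[OF assms(1)] image_mono closure_subset)
    have "closed (f -` closure (f ` ?S))"
      using assms(2) by (simp add: continuous_on_closed_vimage)
    then have "closure ?S \<subseteq> f -` closure (f ` ?S)"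
      using closure_subset[of "f ` ?S"] by (intro closure_minimal) auto
    then show "f ` closure ?S \<subseteq> closure (f ` ?S)" by blast
  qed
  ultimately show ?thesis using True by (simp add: alpha_cut_def)
next
  case False
  with assms(4) have "\<alpha> > 0" by simp
  have "{x. zadeh f u x \<ge> \<alpha>} = f ` {x. u x \<ge> \<alpha>}"
  proof (intro equalityI subsetI)
    fix x assume "x \<in> {x. zadeh f u x \<ge> \<alpha>}"
    then have "zadeh f u x \<ge> \<alpha>" by simp
    with zadeh_attained[OF assms(1-3), of x] \<open>\<alpha> > 0\<close> show "x \<in> f ` {x. u x \<ge> \<alpha>}"
      by (metis imageI less_le_trans mem_Collect_eq)
  next
    fix x assume "x \<in> f ` {x. u x \<ge> \<alpha>}"
    then show "x \<in> {x. zadeh f u x \<ge> \<alpha>}"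
      using zadeh_upper[OF assms(3)] by (auto intro: order_trans)
  qed
  with False show ?thesis by (simp add: alpha_cut_def)
qed

text \<open>Upper semicontinuity is read off from the cuts: a superlevel set at a positive level is
  an image of a compact cut, hence closed, and at other levels it is the whole space.\<close>

lemma zadeh_in_fuzzy_sets:
  fixes f :: "'a::uniform_space \<Rightarrow> 'a"
  assumes "separated_uniformity TYPE('a)" "continuous_on UNIV f" "u \<in> fuzzy_sets"
  shows "zadeh f u \<in> fuzzy_sets"
proof -
  have cut: "compact (alpha_cut (zadeh f u) c)" if "c \<ge> 0" for c
    unfolding alpha_cut_zadeh[OF assms that]
    using compact_alpha_cut[OF assms(3) that] continuous_on_subset[OF assms(2)]
    by (intro compact_continuous_image) auto
  have le1: "zadeh f u x \<le> 1" for x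
    unfolding zadeh_def using fuzzy_setsD(2)[OF assms(3)] by (auto intro!: cSUP_least)
  have ge0: "0 \<le> zadeh f u x" for x
  proof (cases "f -` {x} = {}")
    case False
    then obtain z where "f z = x" by auto
    then show ?thesis
      using zadeh_upper[OF assms(3), of z f] fuzzy_setsD(1)[OF assms(3), of z] by simp
  qed (simp add: zadeh_def)
  obtain z where "u z = 1" using fuzzy_setsD(3)[OF assms(3)] ..
  then have "zadeh f u (f z) = 1"
    using zadeh_upper[OF assms(3), of z f] le1[of "f z"] by simp
  moreover have "closed {x. zadeh f u x \<ge> c}" for c
  proof (cases "c > 0")
    case True
    then show ?thesis
      using compact_imp_closed_separated[OF assms(1) cut[of c]] by (simp add: alpha_cut_def)
  next
    case False
    then have "{x. zadeh f u x \<ge> c} = UNIV" using ge0 by (auto intro: order_trans[of c 0])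
    then show ?thesis by simp
  qed
  ultimately show ?thesis
    using le1 ge0 cut[of 0] by (auto simp: fuzzy_sets_def upper_semicontinuous_iff_closed)
qed

section \<open>Continuity for the Skorokhod uniformity\<close>

lemma time_changes_in_Icc:
  assumes "t \<in> time_changes" "\<alpha> \<in> {0..1}"
  shows "t \<alpha> \<in> {0..1}"
  using assms unfolding time_changes_def homeomorphism_def by blast

text \<open>\<open>U'\<close> is built from the support of \<open>u\<close> alone. The time change
  is kept, so one \<open>U'\<close> serves every \<open>v\<close> and every \<epsilon>. Cuts of
  \<open>v\<close> may leave that support, which is why uniformity of \<open>f\<close> is needed
  with one point unrestricted.\<close>

lemma zadeh_skorokhod_continuous_at:
  fixes f :: "'a::uniform_space \<Rightarrow> 'a"
  assumes "separated_uniformity TYPE('a)" "continuous_on UNIV f" "u \<in> fuzzy_sets"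
    and U: "U \<in> entourages"
  obtains U' where "U' \<in> entourages"
    "\<And>v \<epsilon>. (u, v) \<in> skorokhod_rel U' \<epsilon> \<Longrightarrow> (zadeh f u, zadeh f v) \<in> skorokhod_rel U \<epsilon>"
proof -
  define K where "K = alpha_cut u 0"
  have "compact K" unfolding K_def by (rule fuzzy_setsD(5)[OF assms(3)])
  have "U\<inverse> \<in> entourages"
    using uniformity_sym[of "\<lambda>p. p \<in> U"] U by (simp add: entourages_def case_prod_unfold converse_unfold)
  with U have "U \<inter> U\<inverse> \<in> entourages"
    by (simp add: entourages_def eventually_conj_iff)
  with continuous_uniform_near_compact[OF assms(2) \<open>compact K\<close>]
  have N: "eventually (\<lambda>(x, y). x \<in> K \<longrightarrow> (f x, f y) \<in> U \<inter> U\<inverse>) uniformity" .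
  \<comment> \<open>The cut of \<open>u\<close> supplies the point in \<open>K\<close>, which is the
    first entry of a pair for one Hausdorff inclusion and the second for the other. Hence the two
    clauses, and the converse of \<open>U\<close> to restore the order of the images.\<close>
  define U' where "U' = {(x, y). (x \<in> K \<longrightarrow> (f x, f y) \<in> U \<inter> U\<inverse>) \<and> (y \<in> K \<longrightarrow> (f y, f x) \<in> U \<inter> U\<inverse>)}"
  have "U' \<in> entourages"
    using eventually_conj[OF N uniformity_sym[OF N]]
    by (simp add: U'_def entourages_def case_prod_unfold)
  moreover have "(zadeh f u, zadeh f v) \<in> skorokhod_rel U \<epsilon>" if "(u, v) \<in> skorokhod_rel U' \<epsilon>" for v \<epsilon>
  proof -
    from that obtain t where v: "v \<in> fuzzy_sets" and t: "t \<in> time_changes" "time_norm t < \<epsilon>"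
        "\<And>\<alpha>. \<alpha> \<in> {0..1} \<Longrightarrow> (alpha_cut u \<alpha>, alpha_cut v (t \<alpha>)) \<in> compact_rel U'"
      unfolding skorokhod_rel_def by blast
    have "(alpha_cut (zadeh f u) \<alpha>, alpha_cut (zadeh f v) (t \<alpha>)) \<in> compact_rel U"
      if \<alpha>: "\<alpha> \<in> {0..1}" for \<alpha>
    proof -
      define A B where "A = alpha_cut u \<alpha>" and "B = alpha_cut v (t \<alpha>)"
      have AB: "compact A" "A \<noteq> {}" "compact B" "B \<noteq> {}" "A \<subseteq> U' `` B" "B \<subseteq> U' `` A"
        using t(3)[OF \<alpha>] by (auto simp: compact_rel_def A_def B_def)
      have "A \<subseteq> K" unfolding A_def K_def using \<alpha> by (intro alpha_cut_subset_support) auto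
      have "f ` A \<subseteq> U `` (f ` B)"
        using AB(5) \<open>A \<subseteq> K\<close> unfolding U'_def by blast
      moreover have "f ` B \<subseteq> U `` (f ` A)"
        using AB(6) \<open>A \<subseteq> K\<close> unfolding U'_def by blast
      moreover have "compact (f ` A)" "compact (f ` B)"
        using AB continuous_on_subset[OF assms(2)] by (auto intro!: compact_continuous_image)
      \<comment> \<open>The level \<open>t \<alpha>\<close> is nonnegative, so the cut formula
        applies to \<open>v\<close> as well.\<close>
      moreover have "alpha_cut (zadeh f u) \<alpha> = f ` A" "alpha_cut (zadeh f v) (t \<alpha>) = f ` B"
        using \<alpha> time_changes_in_Icc[OF t(1) \<alpha>]
        by (simp_all add: A_def B_def alpha_cut_zadeh assms v)
      ultimately show ?thesis using AB by (simp add: compact_rel_def)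
    qed
    with t(1,2) zadeh_in_fuzzy_sets[OF assms(1,2)] assms(3) v show ?thesis
      unfolding skorokhod_rel_def by blast
  qed
  ultimately show thesis by (rule that)
qed

theorem theorem2p16:
  fixes f :: "'a::uniform_space \<Rightarrow> 'a"
  assumes "separated_uniformity TYPE('a)"
    and "continuous_on UNIV f"
  shows "continuous_map skorokhod_topology skorokhod_topology (zadeh f)"
  unfolding continuous_map_def topspace_skorokhod_topology
proof (intro conjI allI impI)
  show "zadeh f \<in> fuzzy_sets \<rightarrow> fuzzy_sets"
    using zadeh_in_fuzzy_sets[OF assms] by blast
  fix V assume V: "openin skorokhod_topology (V :: ('a \<Rightarrow> real) set)"
  show "openin skorokhod_topology {u \<in> fuzzy_sets. zadeh f u \<in> V}"
    unfolding openin_skorokhod_topology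
  proof (intro conjI ballI)
    fix u assume u: "u \<in> {u \<in> fuzzy_sets. zadeh f u \<in> V}"
    then obtain W where W: "W \<in> skorokhod_uniformity" "W `` {zadeh f u} \<subseteq> V"
      using V unfolding openin_skorokhod_topology by blast
    then obtain U \<epsilon> where U: "U \<in> entourages" "\<epsilon> > 0" "skorokhod_rel U \<epsilon> \<subseteq> W"
      unfolding skorokhod_uniformity_def by blast
    obtain U' where U': "U' \<in> entourages"
      "\<And>v \<epsilon>. (u, v) \<in> skorokhod_rel U' \<epsilon> \<Longrightarrow> (zadeh f u, zadeh f v) \<in> skorokhod_rel U \<epsilon>"
      using zadeh_skorokhod_continuous_at[OF assms _ U(1)] u by blast
    have sub: "skorokhod_rel U' \<epsilon> \<subseteq> fuzzy_sets \<times> fuzzy_sets"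
      unfolding skorokhod_rel_def by blast
    show "\<exists>W\<in>skorokhod_uniformity. W `` {u} \<subseteq> {u \<in> fuzzy_sets. zadeh f u \<in> V}"
    \<comment> \<open>The basic relation with the same \<epsilon> is itself a member of the
      uniformity.\<close>
    proof
      show "skorokhod_rel U' \<epsilon> \<in> skorokhod_uniformity"
        unfolding skorokhod_uniformity_def using sub U'(1) U(2) by blast
      show "skorokhod_rel U' \<epsilon> `` {u} \<subseteq> {u \<in> fuzzy_sets. zadeh f u \<in> V}"
        using sub U'(2) U(3) W(2) by blast
    qed
  qed blast
qed

end
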